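(* (Central Limit Theorem) Let $\nu\in\mathcal{Q}_3$ and let $X_1,X_2,\dots$ be an i.i.d. sequence of random variables of law $\nu$. For $N\ge 1$ let $\nu_N$ be the law of $\frac{1}{\sqrt{N}}\sum_{k=1}^N X_k$. Then $\mathrm{d}_3(\nu_N,\gamma)\to 0$ as $N\to\infty$, where $\gamma=\mathcal{N}(0,1)$ is the standard normal law; and therefore also $\frac{1}{\sqrt{N}}\sum_{k=1}^N X_k$ converges in law to $\mathcal{N}(0,1)$ as $N\to\infty$.
   Context: $\mathcal{Q}_3$ is the set of Borel probability measures $\nu$ on $\mathbb{R}$ with finite third absolute moment, mean $0$ and variance $1$: $\int |x|^3\,d\nu(x)<\infty$, $\int x\,d\nu(x)=0$, $\int x^2\,d\nu(x)=1$. For a probability measure $\nu$ on $\mathbb{R}$, $\varphi_\nu(\xi)=\int e^{\mathrm{i}x\xi}\,d\nu(x)$ is its characteristic function. For $\nu,\mu\in\mathcal{Q}_3$, $$\mathrm{d}_3(\nu,\mu)=\sup_{\xi\in\mathbb{R}\setminus\{0\}}\frac{|\varphi_\nu(\xi)-\varphi_\mu(\xi)|}{|\xi|^3},$$ which is a finite distance on $\mathcal{Q}_3$. *)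

theory Defs
  imports "HOL-Probability.Probability"
begin

text \<open>
  The locale \<^locale>\<open>real_distribution\<close> is that of the Borel probability measures on the reals.
  Integrability of \<open>\<bar>x\<bar>\<^sup>3\<close> makes \<open>x\<close> and \<open>x\<^sup>2\<close> integrable, so the two Bochner integrals below
  are genuine moments.
\<close>

definition Q3 :: "real measure set" where
  "Q3 = {\<nu>. real_distribution \<nu> \<and> integrable \<nu> (\<lambda>x. \<bar>x\<bar> ^ 3) \<and>
             (LINT x|\<nu>. x) = 0 \<and> (LINT x|\<nu>. x\<^sup>2) = 1}"

text \<open>
  The supremum is taken in \<^typ>\<open>ennreal\<close>, because \<open>Sup\<close> on the reals has no meaningful
  value on an unbounded set.
\<close>

definition d3 :: "real measure \<Rightarrow> real measure \<Rightarrow> ennreal" where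
  "d3 \<nu> \<mu> = (SUP \<xi>\<in>UNIV - {0::real}. ennreal (cmod (char \<nu> \<xi> - char \<mu> \<xi>) / \<bar>\<xi>\<bar> ^ 3))"

end

theory Submission
  imports Defs
begin

text \<open>
  The distance is ideal of order 3: for laws of normalised sums of \<open>N\<close> independent variables,
  \<open>\<bar>a\<^sup>N - b\<^sup>N\<bar> \<le> N \<bar>a - b\<bar>\<close> on the unit disc costs a factor \<open>N\<close>, while the rescaling by
  \<open>1 / sqrt N\<close> gains \<open>N\<close> to the power \<open>-3/2\<close>. As the standard normal law is a fixed point of
  this operation, its distance to the normalised sum is at most \<open>1 / sqrt N\<close> times its distance
  to \<open>\<nu>\<close>, which is finite since the characteristic functions agree up to order 2 at the origin.
  Convergence in the distance gives pointwise convergence of characteristic functions, and hence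
  weak convergence by Levy's continuity theorem.
\<close>

text \<open>The constant covers \<open>\<bar>x\<bar> \<le> 1\<close>, the top power the rest.
  Constants being integrable over a probability measure, a finite third absolute moment thus yields
  the first two moments.\<close>

lemma abs_power_le_one_plus_abs_power:
  fixes x :: real
  assumes "k \<le> n"
  shows "\<bar>x\<bar> ^ k \<le> 1 + \<bar>x\<bar> ^ n"
proof (cases "\<bar>x\<bar> \<le> 1")
  case True
  then have "\<bar>x\<bar> ^ k \<le> 1"
    by (simp add: power_le_one)
  then show ?thesis
    by (simp add: add_increasing2)
next
  case False
  then have "\<bar>x\<bar> ^ k \<le> \<bar>x\<bar> ^ n"
    using assms by (intro power_increasing) auto
  then show ?thesis
    by simp
qed

lemma (in real_distribution) integrable_power_mono:
  assumes "integrable M (\<lambda>x. \<bar>x\<bar> ^ n)" and "k \<le> n"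
  shows "integrable M (\<lambda>x. x ^ k)"
proof (rule Bochner_Integration.integrable_bound)
  show "integrable M (\<lambda>x. 1 + \<bar>x\<bar> ^ n)"
    using assms by simp
  show "AE x in M. norm (x ^ k) \<le> norm (1 + \<bar>x\<bar> ^ n)"
    using abs_power_le_one_plus_abs_power[OF assms(2)] by (simp add: power_abs)
qed simp

text \<open>Mean 0 and variance 1 fix the Taylor polynomial of order 2 at the origin, so it is the
  same for every law in \<open>Q3\<close>.\<close>

lemma char_taylor_Q3:
  assumes "\<nu> \<in> Q3"
  shows "cmod (char \<nu> t - (1 - t\<^sup>2 / 2)) \<le> (LINT x|\<nu>. \<bar>x\<bar> ^ 3) / 6 * \<bar>t\<bar> ^ 3"
proof -
  from assms have dist: "real_distribution \<nu>"
    and int3: "integrable \<nu> (\<lambda>x. \<bar>x\<bar> ^ 3)"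
    and mean: "(LINT x|\<nu>. x) = 0" and var: "(LINT x|\<nu>. x\<^sup>2) = 1"
    by (auto simp: Q3_def)
  interpret real_distribution \<nu> by (fact dist)
  have int1: "integrable \<nu> (\<lambda>x. x)" and int2: "integrable \<nu> (\<lambda>x. x\<^sup>2)"
    using integrable_power_mono[OF int3, of 1] integrable_power_mono[OF int3, of 2] by simp_all
  have "cmod (char \<nu> t - (1 - t\<^sup>2 * 1 / 2))
      \<le> t\<^sup>2 / 6 * (LINT x|\<nu>. min (6 * x\<^sup>2) (\<bar>t\<bar> * \<bar>x\<bar> ^ 3))"
    using char_approx3[OF int1 mean int2, of 1 t] by (simp add: mean var)
  \<comment> \<open>Only the cubic branch of the minimum gives order 3 in \<open>t\<close>; the
    other one would stop at order 2.\<close>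
  also have "(LINT x|\<nu>. min (6 * x\<^sup>2) (\<bar>t\<bar> * \<bar>x\<bar> ^ 3)) \<le> (LINT x|\<nu>. \<bar>t\<bar> * \<bar>x\<bar> ^ 3)"
    using int2 int3 by (intro integral_mono) auto
  also have "t\<^sup>2 / 6 * (LINT x|\<nu>. \<bar>t\<bar> * \<bar>x\<bar> ^ 3) = (LINT x|\<nu>. \<bar>x\<bar> ^ 3) / 6 * \<bar>t\<bar> ^ 3"
    by (simp add: power3_eq_cube power2_eq_square)
  finally show ?thesis
    by (simp add: mult_left_mono)
qed

lemma d3_leI:
  assumes "\<And>\<xi>. \<xi> \<noteq> 0 \<Longrightarrow> ennreal (cmod (char \<nu> \<xi> - char \<mu> \<xi>) / \<bar>\<xi>\<bar> ^ 3) \<le> C"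
  shows "d3 \<nu> \<mu> \<le> C"
  unfolding d3_def using assms by (intro SUP_least) auto

lemma d3_upper:
  assumes "\<xi> \<noteq> 0"
  shows "ennreal (cmod (char \<nu> \<xi> - char \<mu> \<xi>) / \<bar>\<xi>\<bar> ^ 3) \<le> d3 \<nu> \<mu>"
  unfolding d3_def using assms by (intro SUP_upper) auto

text \<open>The common polynomial \<open>1 - \<xi>\<^sup>2 / 2\<close> cancels in the difference,
  leaving two cubic remainders.\<close>

lemma d3_finite:
  assumes "\<nu> \<in> Q3" and "\<mu> \<in> Q3"
  shows "d3 \<nu> \<mu> < \<infinity>"
proof -
  let ?C = "(LINT x|\<nu>. \<bar>x\<bar> ^ 3) / 6 + (LINT x|\<mu>. \<bar>x\<bar> ^ 3) / 6"
  have "d3 \<nu> \<mu> \<le> ennreal ?C"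
  proof (intro d3_leI ennreal_leI)
    fix \<xi> :: real
    assume "\<xi> \<noteq> 0"
    have "cmod (char \<nu> \<xi> - char \<mu> \<xi>)
        \<le> cmod (char \<nu> \<xi> - (1 - \<xi>\<^sup>2 / 2)) + cmod (char \<mu> \<xi> - (1 - \<xi>\<^sup>2 / 2))"
      using norm_triangle_ineq4[of "char \<nu> \<xi> - (1 - \<xi>\<^sup>2 / 2)" "char \<mu> \<xi> - (1 - \<xi>\<^sup>2 / 2)"]
      by simp
    also have "\<dots> \<le> ?C * \<bar>\<xi>\<bar> ^ 3"
      using char_taylor_Q3[OF assms(1), of \<xi>] char_taylor_Q3[OF assms(2), of \<xi>]
      unfolding distrib_right by (rule add_mono)
    finally show "cmod (char \<nu> \<xi> - char \<mu> \<xi>) / \<bar>\<xi>\<bar> ^ 3 \<le> ?C"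
      using \<open>\<xi> \<noteq> 0\<close> by (simp add: pos_divide_le_eq)
  qed
  also have "\<dots> < \<infinity>"
    by (simp only: infinity_ennreal_def ennreal_less_top)
  finally show ?thesis .
qed

lemma std_normal_in_Q3: "std_normal_distribution \<in> Q3"
proof -
  have "integrable std_normal_distribution (\<lambda>x. \<bar>x\<bar> ^ 3)"
    using integrable_abs[OF integrable_std_normal_distribution_moment[of 3]]
    by (simp add: power_abs)
  moreover have "(LINT x|std_normal_distribution. x) = 0"
    using integral_std_normal_distribution_moment_odd[of 1] by simp
  moreover have "(LINT x|std_normal_distribution. x\<^sup>2) = 1"
    using std_normal_distribution_even_moments(1)[of 1] by simp
  ultimately show ?thesis
    by (simp add: Q3_def real_dist_normal_dist)
qed

text \<open>Phrased through characteristic functions alone, so that the normal law can serve as both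
  \<open>\<mu>\<close> and \<open>\<mu>'\<close>.\<close>

lemma d3_char_power_le:
  assumes "real_distribution \<nu>" and "real_distribution \<mu>" and "N \<ge> 1"
    and \<nu>': "\<And>\<xi>. char \<nu>' \<xi> = char \<nu> (\<xi> / sqrt N) ^ N"
    and \<mu>': "\<And>\<xi>. char \<mu>' \<xi> = char \<mu> (\<xi> / sqrt N) ^ N"
  shows "d3 \<nu>' \<mu>' \<le> ennreal (1 / sqrt N) * d3 \<nu> \<mu>"
proof (rule d3_leI)
  fix \<xi> :: real
  assume "\<xi> \<noteq> 0"
  let ?s = "sqrt N" and ?\<eta> = "\<xi> / sqrt N"
  have s: "?s > 0" "real N = ?s\<^sup>2"
    using \<open>N \<ge> 1\<close> by simp_all
  have "cmod (char \<nu>' \<xi> - char \<mu>' \<xi>) \<le> N * cmod (char \<nu> ?\<eta> - char \<mu> ?\<eta>)"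
    unfolding \<nu>' \<mu>' using assms(1,2) by (intro norm_power_diff real_distribution.cmod_char_le_1)
  then have "cmod (char \<nu>' \<xi> - char \<mu>' \<xi>) / \<bar>\<xi>\<bar> ^ 3
      \<le> N * cmod (char \<nu> ?\<eta> - char \<mu> ?\<eta>) / \<bar>\<xi>\<bar> ^ 3"
    by (rule divide_right_mono) simp
  \<comment> \<open>With \<open>?\<eta>\<close> as the new frequency,
    \<open>\<bar>\<xi>\<bar> ^ 3\<close> is \<open>?s ^ 3 * \<bar>?\<eta>\<bar> ^ 3\<close>, and
    \<open>N = ?s\<^sup>2\<close> leaves the factor \<open>1 / ?s\<close>.\<close>
  also have "\<dots> = 1 / ?s * (cmod (char \<nu> ?\<eta> - char \<mu> ?\<eta>) / \<bar>?\<eta>\<bar> ^ 3)"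
  proof -
    have "s\<^sup>2 * c / x ^ 3 = 1 / s * (c / (x / s) ^ 3)" if "s > 0" for s c x :: real
      using that by (simp add: power_divide power2_eq_square power3_eq_cube)
    from this[OF s(1), of "cmod (char \<nu> ?\<eta> - char \<mu> ?\<eta>)" "\<bar>\<xi>\<bar>"] show ?thesis
      using s by (simp add: abs_divide)
  qed
  finally have "ennreal (cmod (char \<nu>' \<xi> - char \<mu>' \<xi>) / \<bar>\<xi>\<bar> ^ 3)
      \<le> ennreal (1 / ?s) * ennreal (cmod (char \<nu> ?\<eta> - char \<mu> ?\<eta>) / \<bar>?\<eta>\<bar> ^ 3)"
    by (subst ennreal_mult[symmetric]) (auto intro: ennreal_leI)
  also have "\<dots> \<le> ennreal (1 / ?s) * d3 \<nu> \<mu>"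
    using \<open>\<xi> \<noteq> 0\<close> s by (intro mult_left_mono d3_upper) auto
  finally show "ennreal (cmod (char \<nu>' \<xi> - char \<mu>' \<xi>) / \<bar>\<xi>\<bar> ^ 3) \<le> ennreal (1 / ?s) * d3 \<nu> \<mu>" .
qed

text \<open>The exponent is quadratic in the frequency, so \<open>N\<close> copies of it at
  \<open>\<xi> / sqrt N\<close> add up to the one at \<open>\<xi>\<close>.\<close>

lemma char_std_normal_power:
  assumes "N \<ge> 1"
  shows "char std_normal_distribution \<xi> = char std_normal_distribution (\<xi> / sqrt N) ^ N"
proof -
  have "exp (- (\<xi> / sqrt N)\<^sup>2 / 2) ^ N = exp (real N * (- (\<xi> / sqrt N)\<^sup>2 / 2))"
    by (rule exp_of_nat_mult[symmetric])
  also have "real N * (- (\<xi> / sqrt N)\<^sup>2 / 2) = - (\<xi>\<^sup>2) / 2"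
    using assms by (simp add: power_divide)
  finally show ?thesis
    unfolding char_std_normal_distribution of_real_power[symmetric] by simp
qed

lemma char_distr_mult:
  assumes "Y \<in> borel_measurable M"
  shows "char (distr M borel (\<lambda>\<omega>. c * Y \<omega>)) t = char (distr M borel Y) (t * c)"
  using assms by (simp add: char_def integral_distr mult.assoc)

text \<open>Scaling moves into the argument and independence turns the sum into a product. For
  \<open>N = 0\<close> both sides are 1.\<close>

lemma (in prob_space) char_distr_normalised_sum:
  assumes indep: "indep_vars (\<lambda>_. borel) X {1..}"
    and law: "\<And>k. k \<ge> 1 \<Longrightarrow> distr M borel (X k) = \<nu>"
  shows "char (distr M borel (\<lambda>\<omega>. 1 / sqrt (real N) * (\<Sum>k=1..N. X k \<omega>))) \<xi>
    = char \<nu> (\<xi> / sqrt N) ^ N"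
proof -
  have rv: "X k \<in> borel_measurable M" if "k \<ge> 1" for k
    using indep that by (auto simp: indep_vars_def)
  have "(\<lambda>\<omega>. \<Sum>k=1..N. X k \<omega>) \<in> borel_measurable M"
    using rv by (intro borel_measurable_sum) auto
  then have "char (distr M borel (\<lambda>\<omega>. 1 / sqrt (real N) * (\<Sum>k=1..N. X k \<omega>))) \<xi>
      = char (distr M borel (\<lambda>\<omega>. \<Sum>k=1..N. X k \<omega>)) (\<xi> / sqrt N)"
    by (subst char_distr_mult) simp_all
  also have "\<dots> = (\<Prod>k=1..N. char (distr M borel (X k)) (\<xi> / sqrt N))"
    by (intro char_distr_sum indep_vars_subset[OF indep]) auto
  also have "\<dots> = char \<nu> (\<xi> / sqrt N) ^ N"
    using law by simp
  finally show ?thesis .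
qed

text \<open>At a fixed \<open>t \<noteq> 0\<close> the distance controls the difference up to the
  constant \<open>\<bar>t\<bar> ^ 3\<close>. The supremum omits \<open>t = 0\<close>, where all
  characteristic functions equal 1.\<close>

lemma d3_tendsto_0_imp_char_tendsto:
  assumes "(\<lambda>n. d3 (\<mu> n) \<nu>) \<longlonglongrightarrow> 0"
    and "\<And>n. real_distribution (\<mu> n)" and "real_distribution \<nu>"
  shows "(\<lambda>n. char (\<mu> n) t) \<longlonglongrightarrow> char \<nu> t"
proof (cases "t = 0")
  case True
  then show ?thesis
    using assms(2,3) by (simp add: real_distribution.char_zero)
next
  case False
  have "(\<lambda>n. ennreal (cmod (char (\<mu> n) t - char \<nu> t) / \<bar>t\<bar> ^ 3)) \<longlonglongrightarrow> 0"
    by (rule tendsto_sandwich[OF _ _ tendsto_const assms(1)])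
      (simp_all only: d3_upper[OF False] zero_le eventually_True)
  then have "(\<lambda>n. cmod (char (\<mu> n) t - char \<nu> t) / \<bar>t\<bar> ^ 3) \<longlonglongrightarrow> 0"
    by (simp add: ennreal_0[symmetric] tendsto_ennreal_iff del: ennreal_0)
  from tendsto_mult_right[OF this, of "\<bar>t\<bar> ^ 3"]
  have "(\<lambda>n. cmod (char (\<mu> n) t - char \<nu> t)) \<longlonglongrightarrow> 0"
    using False by simp
  then show ?thesis
    by (simp add: tendsto_norm_zero_iff LIM_zero_iff)
qed

theorem corollary1p4:
  fixes M :: "'a measure"
    and X :: "nat \<Rightarrow> 'a \<Rightarrow> real"
    and \<nu> :: "real measure"
    and \<nu>N :: "nat \<Rightarrow> real measure"
  assumes "\<nu> \<in> Q3"
    and "prob_space M"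
    and "prob_space.indep_vars M (\<lambda>_. borel) X {1..}"
    and "\<And>k. k \<ge> 1 \<Longrightarrow> distr M borel (X k) = \<nu>"
    and "\<And>N. N \<ge> 1 \<Longrightarrow> \<nu>N N = distr M borel (\<lambda>\<omega>. 1 / sqrt (real N) * (\<Sum>k=1..N. X k \<omega>))"
  shows "((\<lambda>N. d3 (\<nu>N N) std_normal_distribution) \<longlonglongrightarrow> 0) \<and>
         weak_conv_m \<nu>N std_normal_distribution"
proof
  let ?\<gamma> = std_normal_distribution
  interpret prob_space M by (fact assms(2))
  have \<nu>: "real_distribution \<nu>"
    using assms(1) by (simp add: Q3_def)
  have bound: "d3 (\<nu>N N) ?\<gamma> \<le> ennreal (1 / sqrt N) * d3 \<nu> ?\<gamma>" if "N \<ge> 1" for N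
    using \<nu> real_dist_normal_dist that
  proof (rule d3_char_power_le)
    show "char (\<nu>N N) \<xi> = char \<nu> (\<xi> / sqrt N) ^ N" for \<xi>
      unfolding assms(5)[OF that] using assms(3,4) by (rule char_distr_normalised_sum)
  qed (rule char_std_normal_power[OF that])
  have "(\<lambda>N. 1 / sqrt (real N)) \<longlonglongrightarrow> 0"
    by real_asymp
  then have "(\<lambda>N. ennreal (1 / sqrt (real N))) \<longlonglongrightarrow> 0"
    using tendsto_ennrealI by fastforce
  \<comment> \<open>Finiteness of \<open>d3 \<nu> ?\<gamma>\<close> rules out the product of 0 and
    infinity, where multiplication on \<open>ennreal\<close> is not continuous.\<close>
  then have "(\<lambda>N. ennreal (1 / sqrt N) * d3 \<nu> ?\<gamma>) \<longlonglongrightarrow> 0 * d3 \<nu> ?\<gamma>"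
    using d3_finite[OF assms(1) std_normal_in_Q3]
    by (intro tendsto_mult_ennreal tendsto_const) auto
  then have upper: "(\<lambda>N. ennreal (1 / sqrt N) * d3 \<nu> ?\<gamma>) \<longlonglongrightarrow> 0"
    by simp
  show conv: "(\<lambda>N. d3 (\<nu>N N) ?\<gamma>) \<longlonglongrightarrow> 0"
    by (rule tendsto_sandwich[OF _ _ tendsto_const upper])
      (auto simp: eventually_sequentially intro!: exI[of _ 1] bound)
  \<comment> \<open>Nothing is assumed about \<open>\<nu>N 0\<close>, which need not be a distribution; hence the shift.\<close>
  have dist: "real_distribution (\<nu>N (Suc n))" for n
  proof -
    have "X k \<in> borel_measurable M" if "k \<ge> 1" for k
      using assms(3) that by (auto simp: indep_vars_def)
    then have "(\<lambda>\<omega>. 1 / sqrt (real (Suc n)) * (\<Sum>k=1..Suc n. X k \<omega>)) \<in> borel_measurable M"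
      by (intro borel_measurable_times borel_measurable_sum) auto
    then show ?thesis
      by (simp add: assms(5) real_distribution_distr del: sum.cl_ivl_Suc)
  qed
  have "weak_conv_m (\<lambda>n. \<nu>N (Suc n)) ?\<gamma>"
    using dist real_dist_normal_dist
    by (intro levy_continuity d3_tendsto_0_imp_char_tendsto LIMSEQ_Suc[OF conv])
  \<comment> \<open>Weak convergence is a statement on limits of \<open>cdf\<close> values at
    continuity points, and these limits ignore the shift.\<close>
  then show "weak_conv_m \<nu>N ?\<gamma>"
    unfolding weak_conv_m_def weak_conv_def by (simp add: filterlim_sequentially_Suc[where f = "\<lambda>n. cdf (\<nu>N n) x" for x])
qed

end
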